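(* Let $n$ be an odd positive integer such that $2n+1$ is prime. Then the complete graph $K_n$ has an orthogonal double cover by Hamiltonian paths.
   Context: For a graph $G$ on $n$ vertices, an orthogonal double cover (ODC) of the complete graph $K_n$ by $G$ is a collection $\{G_i : 1 \le i \le n\}$ of $n$ subgraphs of $K_n$, each isomorphic to $G$, such that (1) every edge of $K_n$ lies in exactly two of the $G_i$, and (2) any two distinct graphs $G_i, G_j$ have exactly one edge in common. Here $G$ is a Hamiltonian path on $n$ vertices. *)

theory Defs
  imports "Graph_Theory.Graph_Theory" "HOL-Computational_Algebra.Primes"
begin

text \<open>
  Simple graphs are represented as in the theory \<^verbatim>\<open>Kuratowski\<close> of the entry
  \<^verbatim>\<open>Graph_Theory\<close>: as symmetric loop-free digraphs (\<^const>\<open>pair_graph\<close>), in which an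
  undirected edge is a pair of opposite arcs. Edges are counted undirected, so they are taken
  as two-element sets here.
\<close>

definition uedges :: "'a pair_pre_digraph \<Rightarrow> 'a set set" where
  "uedges G = {{u, v} | u v. (u, v) \<in> parcs G}"

definition path_graph :: "nat \<Rightarrow> nat pair_pre_digraph" where
  "path_graph n = \<lparr> pverts = {..<n},
     parcs = {(i, j). i < n \<and> j < n \<and> (j = Suc i \<or> i = Suc j)} \<rparr>"

lemma pair_graph_path_graph: "pair_graph (path_graph n)"
proof -
  have "parcs (path_graph n) \<subseteq> {..<n} \<times> {..<n}"
    by (auto simp: path_graph_def)
  then have "finite (parcs (path_graph n))"
    by (rule finite_subset) simp
  then show ?thesis
    by unfold_locales (auto simp: path_graph_def symmetric_def intro!: symI)
qed

text \<open>
  The cover is a family indexed by \<open>1..n\<close>, and both conditions count indices: an edge lies in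
  the members with exactly two indices, and members with different indices share one edge.
  Since the graph \<open>G\<close> has \<open>n\<close> vertices, each member is a spanning subgraph of \<open>K\<close>.
\<close>

definition orthogonal_double_cover ::
  "nat \<Rightarrow> 'a pair_pre_digraph \<Rightarrow> 'b pair_pre_digraph \<Rightarrow> (nat \<Rightarrow> 'a pair_pre_digraph) \<Rightarrow> bool" where
  "orthogonal_double_cover n K G H \<longleftrightarrow>
     complete_digraph n (with_proj K) \<and>
     pair_graph G \<and> card (pverts G) = n \<and>
     (\<forall>i\<in>{1..n}. subgraph (with_proj (H i)) (with_proj K) \<and>
                 digraph_iso (with_proj G) (with_proj (H i))) \<and>
     (\<forall>e\<in>uedges K. card {i\<in>{1..n}. e \<in> uedges (H i)} = 2) \<and>
     (\<forall>i\<in>{1..n}. \<forall>j\<in>{1..n}. i \<noteq> j \<longrightarrow> card (uedges (H i) \<inter> uedges (H j)) = 1)"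

end

theory Submission
  imports Defs
begin

text \<open>
  Identify the vertices with \<open>{1..n}\<close>, the nonzero residues modulo \<open>p = 2n + 1\<close> up to sign, and
  let the \<open>i\<close>-th path be the multiple \<open>i, 2i, \<dots>, ni\<close> of the path \<open>1, 2, \<dots>, n\<close>. Since consecutive
  multiples differ by \<open>i\<close> and the path exhausts all classes, \<open>u\<close> and \<open>v\<close> are adjacent in it iff
  \<open>i \<equiv> \<plusminus>u \<plusminus> v\<close>. So \<open>{u, v}\<close> lies exactly in the paths with index \<open>\<bar>u - v\<bar>\<close> and \<open>\<bar>u + v\<bar>\<close>, and
  two paths \<open>i\<close> and \<open>j\<close> share exactly the edge with ends \<open>(i + j)/2\<close> and \<open>(i - j)/2\<close>, taken up to
  sign.
\<close>

section \<open>Adjacency up to sign modulo 2n + 1\<close>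

text \<open>The congruence is written as equations of natural numbers, open to linear arithmetic.
  The clause \<open>u \<noteq> v\<close> removes a loop at the end of the path, since ni and (n +
  1)i agree up to sign.\<close>

definition sgn_adj :: "nat \<Rightarrow> nat \<Rightarrow> nat \<Rightarrow> nat \<Rightarrow> bool" where
  "sgn_adj n i u v \<longleftrightarrow> u \<in> {1..n} \<and> v \<in> {1..n} \<and> u \<noteq> v \<and>
     (u = v + i \<or> v = u + i \<or> u + v = i \<or> u + v + i = 2 * n + 1)"

lemma sgn_adj_sym: "sgn_adj n i u v \<longleftrightarrow> sgn_adj n i v u"
  by (auto simp: sgn_adj_def)

lemma card_sgn_adj_index:
  assumes "u \<in> {1..n}" "v \<in> {1..n}" "u \<noteq> v"
  shows "card {i \<in> {1..n}. sgn_adj n i u v} = 2"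
proof -
  \<comment> \<open>\<open>d\<close> and \<open>s\<close> represent u - v and u + v up to sign in
    {1..n}.\<close>
  define d where "d = (if u \<le> v then v - u else u - v)"
  define s where "s = (if u + v \<le> n then u + v else 2 * n + 1 - (u + v))"
  have "{i \<in> {1..n}. sgn_adj n i u v} = {d, s}"
    using assms by (auto simp: sgn_adj_def d_def s_def)
  moreover have "d \<noteq> s"
  proof
    assume "d = s"
    \<comment> \<open>With s = u + v one of the vertices would be 0; the other case gives this
      equation, impossible by parity.\<close>
    then have "2 * max u v = 2 * n + 1"
      using assms by (auto simp: d_def s_def max_def split: if_splits)
    then show False by presburger
  qed
  ultimately show ?thesis by simp
qed

text \<open>Two differences would give i = j, and two sums i = j or i + j = 2n + 1. A difference j
  with sum i makes the smaller end negative, and with sum 2n + 1 - i it makes the larger end exceed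
  n.\<close>

lemma sgn_adj_common:
  assumes "i < j" "j \<le> n" "sgn_adj n i u v" "sgn_adj n j u v"
  shows "(u = v + i \<or> v = u + i) \<and> (u + v = j \<or> u + v + j = 2 * n + 1)"
proof -
  have "u = v + i \<or> v = u + i \<or> u + v = i \<or> u + v + i = 2 * n + 1"
    and "u = v + j \<or> v = u + j \<or> u + v = j \<or> u + v + j = 2 * n + 1"
    and "u \<le> n" "v \<le> n" "0 < u" "0 < v"
    using assms(3,4) by (auto simp: sgn_adj_def)
  then show ?thesis
    using assms(1,2) by (elim disjE) linarith+
qed

text \<open>By \<open>sgn_adj_common\<close> the ends differ by i. Their sum has the parity of i, so
  the parity of i + j decides between the sums j and 2n + 1 - j, and both ends are
  determined.\<close>

lemma ex1_sgn_adj_common: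
  assumes "i \<in> {1..n}" "j \<in> {1..n}" "i < j"
  obtains a b where "sgn_adj n i a b" "sgn_adj n j a b"
    "\<And>u v. sgn_adj n i u v \<Longrightarrow> sgn_adj n j u v \<Longrightarrow> {u, v} = {a, b}"
proof (cases "even (i + j)")
  case True
  define a b where "a = (j - i) div 2" and "b = (i + j) div 2"
  have ab: "2 * a + i = j" "2 * b = i + j"
    using True \<open>i < j\<close> unfolding a_def b_def by presburger+
  show ?thesis
  proof
    show "sgn_adj n i a b" "sgn_adj n j a b"
      using assms ab by (auto simp: sgn_adj_def)
    fix u v assume uv: "sgn_adj n i u v" "sgn_adj n j u v"
    have *: "(u = v + i \<or> v = u + i) \<and> (u + v = j \<or> u + v + j = 2 * n + 1)"
      using sgn_adj_common[OF _ _ uv] assms by simp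
    then have "even (u + v + j)" using True by auto
    then have "u + v + j \<noteq> 2 * n + 1" by (metis even_add dvd_triv_left odd_one)
    with * have "u + v = j" by blast
    with * ab show "{u, v} = {a, b}" by (auto simp: doubleton_eq_iff)
  qed
next
  case False
  then obtain k where k: "i + j = 2 * k + 1" by (elim oddE)
  \<comment> \<open>Halves modulo 2n + 1: \<open>a\<close> is -(i + j)/2 and \<open>b\<close> is (i
    - j)/2. The subtraction is proper because k < n.\<close>
  define a b where "a = n - k" and "b = n - k + i"
  have ab: "2 * a + i + j = 2 * n + 1" "2 * b + j = 2 * n + 1 + i"
    using k assms by (auto simp: a_def b_def)
  show ?thesis
  proof
    show "sgn_adj n i a b" "sgn_adj n j a b"
      using assms ab by (auto simp: sgn_adj_def)
    fix u v assume uv: "sgn_adj n i u v" "sgn_adj n j u v"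
    have *: "(u = v + i \<or> v = u + i) \<and> (u + v = j \<or> u + v + j = 2 * n + 1)"
      using sgn_adj_common[OF _ _ uv] assms by simp
    then have "odd (u + v + j)" using False by auto
    then have "u + v + j = 2 * n + 1" using * by auto
    with * ab show "{u, v} = {a, b}" by (auto simp: doubleton_eq_iff)
  qed
qed

text \<open>This passes from equations to congruences, where multiplication by i acts. Three of the
  four sums are below 2n + 1 in absolute value, so they must vanish; u + v + i lies strictly between
  0 and 2(2n + 1), so it must be 2n + 1.\<close>

lemma sgn_adj_iff_dvd:
  assumes "i \<in> {1..n}" "u \<in> {1..n}" "v \<in> {1..n}" "u \<noteq> v"
  shows "sgn_adj n i u v \<longleftrightarrow>
    (\<exists>s\<in>{1, -1}. \<exists>t\<in>{1, -1}. int (2 * n + 1) dvd int u + s * int v + t * int i)"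
    (is "_ \<longleftrightarrow> ?R")
proof -
  let ?p = "int (2 * n + 1)"
  have small: "?p dvd x \<longleftrightarrow> x = 0" if "\<bar>x\<bar> < ?p" for x
    using that dvd_imp_le_int[of x ?p] by (cases "x = 0") auto
  have 1: "?p dvd int u + int v + int i \<longleftrightarrow> u + v + i = 2 * n + 1"
  proof -
    have "?p dvd int u + int v + int i \<longleftrightarrow> ?p dvd int u + int v + int i - ?p"
      by (simp only: dvd_diff_left_iff dvd_refl)
    also have "\<dots> \<longleftrightarrow> int u + int v + int i - ?p = 0"
      using assms by (intro small) auto
    finally show ?thesis by auto
  qed
  have 2: "?p dvd int u + int v - int i \<longleftrightarrow> u + v = i"
    using assms by (subst small) auto
  have 3: "?p dvd int u - int v + int i \<longleftrightarrow> v = u + i"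
    using assms by (subst small) auto
  have 4: "?p dvd int u - int v - int i \<longleftrightarrow> u = v + i"
    using assms by (subst small) auto
  have "?R \<longleftrightarrow> ?p dvd int u + int v + int i \<or> ?p dvd int u + int v - int i \<or>
      ?p dvd int u - int v + int i \<or> ?p dvd int u - int v - int i"
    by (simp del: of_nat_add of_nat_mult)
  then show ?thesis
    unfolding 1 2 3 4 sgn_adj_def using assms by blast
qed

section \<open>Multiplication by \<open>i\<close> on absolute residues\<close>

text \<open>The absolute value of the residue of x nearest to 0, which represents x up to sign in
  {0..n}.\<close>

definition abs_res :: "nat \<Rightarrow> nat \<Rightarrow> nat" where
  "abs_res n x = min (x mod (2 * n + 1)) (2 * n + 1 - x mod (2 * n + 1))"

lemma abs_res_cong:
  obtains s where "s \<in> {1, -1}" "int (2 * n + 1) dvd int (abs_res n x) - s * int x"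
proof (cases "x mod (2 * n + 1) \<le> n")
  case True
  then have "int (abs_res n x) = int x mod int (2 * n + 1)"
    by (simp add: abs_res_def zmod_int)
  then show ?thesis
    by (intro that[of 1]) (simp_all flip: mod_eq_dvd_iff)
next
  case False
  have "x mod (2 * n + 1) < 2 * n + 1" by simp
  with False have "int (abs_res n x) = int (2 * n + 1) - int x mod int (2 * n + 1)"
    by (simp add: abs_res_def zmod_int of_nat_diff)
  then have "int (abs_res n x) + int x = int (2 * n + 1) * (1 + int x div int (2 * n + 1))"
    using div_mult_mod_eq[of "int x" "int (2 * n + 1)"] by (simp add: algebra_simps)
  then show ?thesis
    by (intro that[of "-1"]) (simp_all del: of_nat_add of_nat_mult)
qed

lemma abs_res_range:
  assumes "\<not> 2 * n + 1 dvd x"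
  shows "abs_res n x \<in> {1..n}"
proof -
  define y where "y = x mod (2 * n + 1)"
  have "y \<noteq> 0" "y < 2 * n + 1"
    using assms by (auto simp: y_def dvd_eq_mod_eq_0)
  then show ?thesis unfolding abs_res_def y_def[symmetric] by auto
qed

text \<open>Passing to absolute residues changes only signs, which the quantifiers absorb, and i
  cancels modulo the prime. The parameter c is 0 for injectivity and 1 for adjacency.\<close>

lemma abs_res_mult_dvd_iff:
  assumes "prime (2 * n + 1)" "i \<in> {1..n}"
  shows "(\<exists>s\<in>{1, -1}. \<exists>t\<in>{1, -1}.
      int (2 * n + 1) dvd int (abs_res n (i * a)) + s * int (abs_res n (i * b)) + t * (int i * c)) \<longleftrightarrow>
    (\<exists>s\<in>{1, -1}. \<exists>t\<in>{1, -1}. int (2 * n + 1) dvd int a + s * int b + t * c)"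
    (is "?L \<longleftrightarrow> ?R")
proof -
  let ?p = "int (2 * n + 1)"
  obtain e where e: "e \<in> {1, -1}" "?p dvd int (abs_res n (i * a)) - e * int (i * a)"
    by (rule abs_res_cong)
  obtain f where f: "f \<in> {1, -1}" "?p dvd int (abs_res n (i * b)) - f * int (i * b)"
    by (rule abs_res_cong)
  have "prime ?p" using assms(1) by (metis prime_int_nat_transfer prime_nat_int_transfer)
  moreover have "\<not> ?p dvd int i" using assms(2) by (auto dest: zdvd_imp_le)
  ultimately have cancel: "?p dvd int i * x \<longleftrightarrow> ?p dvd x" for x
    by (auto simp: prime_dvd_mult_iff)
  \<comment> \<open>The map from (s, t) to (e s f, e t) permutes the pairs of signs.\<close>
  have key: "?p dvd int (abs_res n (i * a)) + s * int (abs_res n (i * b)) + t * (int i * c) \<longleftrightarrow>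
      ?p dvd int a + (e * s * f) * int b + (e * t) * c" for s t
  proof -
    have "?p dvd (int (abs_res n (i * a)) - e * int (i * a)) +
        s * (int (abs_res n (i * b)) - f * int (i * b))"
      using e f by (intro dvd_add dvd_mult)
    moreover have ee: "e * (e * x) = x" for x using e(1) by auto
    moreover have "int (abs_res n (i * a)) + s * int (abs_res n (i * b)) + t * (int i * c) =
      (int (abs_res n (i * a)) - e * int (i * a)) + s * (int (abs_res n (i * b)) - f * int (i * b)) +
      int i * (e * (int a + (e * s * f) * int b + (e * t) * c))"
      by (simp add: algebra_simps ee)
    ultimately have "?p dvd int (abs_res n (i * a)) + s * int (abs_res n (i * b)) + t * (int i * c) \<longleftrightarrow>
        ?p dvd int i * (e * (int a + (e * s * f) * int b + (e * t) * c))"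
      by (simp only: dvd_add_right_iff)
    also have "\<dots> \<longleftrightarrow> ?p dvd e * (int a + (e * s * f) * int b + (e * t) * c)"
      by (rule cancel)
    also have "\<dots> \<longleftrightarrow> ?p dvd int a + (e * s * f) * int b + (e * t) * c"
      using e(1) by (auto simp only: insert_iff empty_iff mult_1 mult_minus1 dvd_minus_iff)
    finally show ?thesis .
  qed
  show ?thesis unfolding key using e(1) f(1)
    by (elim insertE emptyE) (auto simp del: of_nat_add of_nat_mult)
qed

text \<open>The case c = 0 gives a \<equiv> \<pm>b, hence a = b in {1..n}; an injective self-map of
  a finite set is onto.\<close>

lemma abs_res_mult_bij:
  assumes "prime (2 * n + 1)" "i \<in> {1..n}"
  shows "bij_betw (\<lambda>a. abs_res n (i * a)) {1..n} {1..n}"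
proof -
  let ?p = "int (2 * n + 1)"
  have range: "abs_res n (i * a) \<in> {1..n}" if "a \<in> {1..n}" for a
  proof (rule abs_res_range)
    have "\<not> 2 * n + 1 dvd i" "\<not> 2 * n + 1 dvd a"
      using that assms(2) by (auto dest: dvd_imp_le)
    then show "\<not> 2 * n + 1 dvd i * a"
      using assms(1) prime_dvd_mult_iff by blast
  qed
  moreover have "inj_on (\<lambda>a. abs_res n (i * a)) {1..n}"
  proof (rule inj_onI)
    fix a b assume ab: "a \<in> {1..n}" "b \<in> {1..n}" "abs_res n (i * a) = abs_res n (i * b)"
    have "\<exists>s\<in>{1, -1}. \<exists>t\<in>{1, -1}.
      ?p dvd int (abs_res n (i * a)) + s * int (abs_res n (i * b)) + t * (int i * 0)"
      unfolding ab(3) by (intro bexI[of _ "-1"] bexI[of _ 1]) simp_all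
    then have "\<exists>s\<in>{1, -1}. \<exists>t\<in>{1, -1}. ?p dvd int a + s * int b + t * 0"
      using abs_res_mult_dvd_iff[OF assms, of a b 0] by blast
    then have "?p dvd int a + int b \<or> ?p dvd int a - int b"
      by (auto simp del: of_nat_add of_nat_mult)
    moreover have "\<not> ?p dvd int a + int b"
      using ab by (auto dest: zdvd_imp_le)
    ultimately have "?p dvd int a - int b" by blast
    then show "a = b"
      using dvd_imp_le_int[of "int a - int b" ?p] ab by fastforce
  qed
  ultimately show ?thesis
    by (intro bij_betw_imageI endo_inj_surj) auto
qed

lemma sgn_adj_abs_res_mult:
  assumes "prime (2 * n + 1)" "i \<in> {1..n}" "a \<in> {1..n}" "b \<in> {1..n}"
  shows "sgn_adj n i (abs_res n (i * a)) (abs_res n (i * b)) \<longleftrightarrow> a = Suc b \<or> b = Suc a"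
proof (cases "a = b")
  case True
  then show ?thesis by (simp add: sgn_adj_def)
next
  case False
  note bij = abs_res_mult_bij[OF assms(1,2)]
  have ne: "abs_res n (i * a) \<noteq> abs_res n (i * b)"
    using False assms inj_onD[OF bij_betw_imp_inj_on[OF bij]] by blast
  have "sgn_adj n i (abs_res n (i * a)) (abs_res n (i * b)) \<longleftrightarrow> sgn_adj n 1 a b"
    using abs_res_mult_dvd_iff[OF assms(1,2), of a b 1] assms ne False
      bij_betwE[OF bij] by (subst (1 2) sgn_adj_iff_dvd) auto
  \<comment> \<open>The sum a + b = 1 is too small, and a + b = 2n would force a = b = n.\<close>
  also have "\<dots> \<longleftrightarrow> a = Suc b \<or> b = Suc a"
    using assms False by (auto simp: sgn_adj_def)
  finally show ?thesis .
qed

section \<open>Realisation as subgraphs of \<open>K\<close>\<close>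

text \<open>Arcs are pairs of vertices, so the vertex bijection induces the arc map, injective
  because all arcs lie in the square of the vertex set.\<close>

lemma digraph_iso_with_projI:
  assumes "pair_wf_digraph G" "bij_betw g (pverts G) (pverts H)"
    and "parcs H = map_prod g g ` parcs G"
  shows "digraph_iso (with_proj G) (with_proj H)"
proof -
  interpret pair_wf_digraph G by fact
  define hom where "hom = \<lparr> iso_verts = g, iso_arcs = map_prod g g, iso_head = snd, iso_tail = fst \<rparr>"
  have "parcs G \<subseteq> pverts G \<times> pverts G"
    using in_arcsD1 in_arcsD2 by auto
  moreover have "inj_on (map_prod g g) (pverts G \<times> pverts G)"
    using assms(2) by (intro map_prod_inj_on) (auto simp: bij_betw_def)
  ultimately have "inj_on (map_prod g g) (parcs G)"
    by (rule inj_on_subset[rotated])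
  then have "pre_digraph.digraph_isomorphism (with_proj G) hom"
    using assms(2) wf_digraph
    by (simp add: pre_digraph.digraph_isomorphism_def hom_def bij_betw_def)
  moreover have "with_proj H = app_iso hom (with_proj G)"
    using assms(2,3) by (simp add: app_iso_def with_proj_def hom_def bij_betw_def)
  ultimately show ?thesis unfolding digraph_iso_def by blast
qed

text \<open>Defined by adjacency instead of the list of multiples, so that edges can be counted
  directly; \<open>f\<close> labels the vertices of the complete graph.\<close>

definition mult_path :: "nat \<Rightarrow> (nat \<Rightarrow> 'a) \<Rightarrow> nat \<Rightarrow> 'a pair_pre_digraph" where
  "mult_path n f i = \<lparr> pverts = f ` {1..n}, parcs = {(f u, f v) | u v. sgn_adj n i u v} \<rparr>"

lemma digraph_iso_mult_path:
  assumes "prime (2 * n + 1)" "i \<in> {1..n}" "inj_on f {1..n}"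
  shows "digraph_iso (with_proj (path_graph n)) (with_proj (mult_path n f i))"
proof (rule digraph_iso_with_projI)
  interpret pair_graph "path_graph n" by (rule pair_graph_path_graph)
  show "pair_wf_digraph (path_graph n)" by unfold_locales
  define r where "r = (\<lambda>a. abs_res n (i * a))"
  have r: "bij_betw r {1..n} {1..n}"
    unfolding r_def by (rule abs_res_mult_bij[OF assms(1,2)])
  \<comment> \<open>The vertices of \<open>path_graph\<close> start at 0 but the multiples at i, so
    k is sent to (k + 1)i.\<close>
  have Suc: "bij_betw Suc {..<n} {1..n}"
    by (simp add: bij_betw_def lessThan_atLeast0 image_Suc_atLeastLessThan atLeastLessThanSuc_atLeastAtMost)
  have "bij_betw (f \<circ> (r \<circ> Suc)) {..<n} (f ` {1..n})"
    using Suc r assms(3) by (intro bij_betw_trans) (auto simp: bij_betw_def)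
  then show "bij_betw (f \<circ> r \<circ> Suc) (pverts (path_graph n)) (pverts (mult_path n f i))"
    by (simp add: path_graph_def mult_path_def comp_assoc)
  have adj: "sgn_adj n i (r (Suc k)) (r (Suc l)) \<longleftrightarrow> k = Suc l \<or> l = Suc k"
    if "k < n" "l < n" for k l
    unfolding r_def using sgn_adj_abs_res_mult[OF assms(1,2), of "Suc k" "Suc l"] that by simp
  \<comment> \<open>Every end of an edge is a multiple of i up to sign, so no edge lies outside the
    image.\<close>
  have surj: "\<exists>k<n. u = r (Suc k)" if "u \<in> {1..n}" for u
  proof -
    have "r ` Suc ` {..<n} = {1..n}"
      using r Suc by (simp only: bij_betw_imp_surj_on)
    with that show ?thesis by blast
  qed
  show "parcs (mult_path n f i) =
    map_prod (f \<circ> r \<circ> Suc) (f \<circ> r \<circ> Suc) ` parcs (path_graph n)" (is "?L = ?R")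
  proof (intro equalityI subsetI)
    fix x assume "x \<in> ?L"
    then obtain u v where uv: "x = (f u, f v)" "sgn_adj n i u v"
      by (auto simp: mult_path_def)
    moreover obtain k where "k < n" "u = r (Suc k)"
      using surj uv(2) unfolding sgn_adj_def by blast
    moreover obtain l where "l < n" "v = r (Suc l)"
      using surj uv(2) unfolding sgn_adj_def by blast
    ultimately show "x \<in> ?R"
      using uv adj by (intro image_eqI[of _ _ "(k, l)"]) (auto simp: path_graph_def)
  next
    fix x assume "x \<in> ?R"
    then show "x \<in> ?L"
      using adj by (fastforce simp: path_graph_def mult_path_def)
  qed
qed

lemma mem_uedges_mult_path:
  assumes "inj_on f {1..n}" "u \<in> {1..n}" "v \<in> {1..n}"
  shows "{f u, f v} \<in> uedges (mult_path n f i) \<longleftrightarrow> sgn_adj n i u v"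
proof
  assume "{f u, f v} \<in> uedges (mult_path n f i)"
  then obtain a b where ab: "{f u, f v} = {f a, f b}" "sgn_adj n i a b"
    by (auto simp: uedges_def mult_path_def)
  then have "u = a \<and> v = b \<or> u = b \<and> v = a"
    using assms by (auto simp: doubleton_eq_iff sgn_adj_def dest: inj_onD)
  with ab(2) show "sgn_adj n i u v"
    using sgn_adj_sym by blast
qed (auto simp: uedges_def mult_path_def)

lemma card_uedges_mult_path_Int:
  assumes "inj_on f {1..n}" "i \<in> {1..n}" "j \<in> {1..n}" "i < j"
  shows "card (uedges (mult_path n f i) \<inter> uedges (mult_path n f j)) = 1"
proof -
  obtain a b where ab: "sgn_adj n i a b" "sgn_adj n j a b"
    and uniq: "\<And>u v. sgn_adj n i u v \<Longrightarrow> sgn_adj n j u v \<Longrightarrow> {u, v} = {a, b}"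
    using ex1_sgn_adj_common[OF assms(2-4)] by metis
  have "uedges (mult_path n f i) \<inter> uedges (mult_path n f j) = {{f a, f b}}"
  proof (intro equalityI subsetI)
    fix e assume e: "e \<in> uedges (mult_path n f i) \<inter> uedges (mult_path n f j)"
    then obtain u v where uv: "e = {f u, f v}" "sgn_adj n i u v"
      by (auto simp: uedges_def mult_path_def)
    \<comment> \<open>Labels taken from the first path also serve in the second, as \<open>f\<close>
      is injective.\<close>
    moreover have "sgn_adj n j u v"
      using e uv mem_uedges_mult_path[OF assms(1)] by (auto simp: sgn_adj_def)
    ultimately have "f ` {u, v} = f ` {a, b}" using uniq by metis
    then show "e \<in> {{f a, f b}}" using uv by simp
  qed (use ab in \<open>auto simp: uedges_def mult_path_def\<close>)
  then show ?thesis by simp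
qed

theorem theorem1p2:
  fixes n :: nat and K :: "'a pair_pre_digraph"
  assumes "odd n" and "prime (2 * n + 1)"
    and "complete_digraph n (with_proj K)"
  shows "\<exists>H. orthogonal_double_cover n K (path_graph n) H"
proof -
  have K: "finite (pverts K)" "card (pverts K) = n"
    "parcs K = {(u, v). (u, v) \<in> pverts K \<times> pverts K \<and> u \<noteq> v}"
    using assms(3) by (auto simp: complete_digraph_pair_def)
  obtain f where "bij_betw f {1..n} (pverts K)"
    using K(1,2) ex_bij_betw_nat_finite_1 by blast
  then have inj: "inj_on f {1..n}" and verts: "pverts K = f ` {1..n}"
    by (auto simp: bij_betw_def)
  have "subgraph (with_proj (mult_path n f i)) (with_proj K)" for i
  proof -
    have "wf_digraph (with_proj K)" "wf_digraph (with_proj (mult_path n f i))"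
      by (auto simp: wf_digraph_def K(3) mult_path_def sgn_adj_def)
    then show ?thesis using inj
      by (auto simp: subgraph_def compatible_def K(3) verts mult_path_def sgn_adj_def dest: inj_onD)
  qed
  moreover have "card {i \<in> {1..n}. e \<in> uedges (mult_path n f i)} = 2" if "e \<in> uedges K" for e
  proof -
    from that obtain x y where xy: "e = {x, y}" "x \<in> f ` {1..n}" "y \<in> f ` {1..n}" "x \<noteq> y"
      unfolding uedges_def K(3) verts by blast
    then obtain u v where uv: "e = {f u, f v}" "u \<in> {1..n}" "v \<in> {1..n}" "u \<noteq> v"
      by blast
    then show ?thesis
      using card_sgn_adj_index mem_uedges_mult_path[OF inj] by simp
  qed
  \<comment> \<open>For j < i the roles are swapped, since intersection commutes.\<close>
  moreover have "card (uedges (mult_path n f i) \<inter> uedges (mult_path n f j)) = 1"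
    if "i \<in> {1..n}" "j \<in> {1..n}" "i \<noteq> j" for i j
    using card_uedges_mult_path_Int[OF inj, of i j] card_uedges_mult_path_Int[OF inj, of j i] that
    by (cases "i < j") (simp_all add: Int_commute)
  ultimately have "orthogonal_double_cover n K (path_graph n) (mult_path n f)"
    using assms(3) pair_graph_path_graph digraph_iso_mult_path[OF assms(2) _ inj]
    unfolding orthogonal_double_cover_def by (simp add: path_graph_def)
  then show ?thesis by blast
qed

end
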